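(* For all integers $n\ge 0$, $$\overline{\sigma_o\mathrm{mex}}(n)\equiv \overline{p}_{\ge 2}(n)\pmod 4,$$ where $\overline{p}_{\ge 2}(n)$ denotes the number of overpartitions of $n$ with all parts at least $2$.
   Context: An overpartition of a nonnegative integer $n$ is a non-increasing sequence of positive integers summing to $n$ in which the first occurrence of each distinct integer may (or may not) be overlined; $\overline{\mathcal P}(n)$ denotes the set of all overpartitions of $n$ (the only overpartition of $0$ is the empty one, so $\overline{p}_{\ge2}(0)=1$). For an overpartition $\lambda$, $\mathrm{mex}(\lambda)$ is the least positive integer that does not occur as a part of $\lambda$, where a value counts as occurring whether it appears overlined or non-overlined. Put $\mathrm{mex}_o(\lambda)=\mathrm{mex}(\lambda)$ if $\mathrm{mex}(\lambda)$ is odd and $\mathrm{mex}_o(\lambda)=0$ otherwise. Define $\overline{\sigma_o\mathrm{mex}}(n)=\sum_{\lambda\in\overline{\mathcal P}(n)}\mathrm{mex}_o(\lambda)$ for $n\ge 0$. *)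

theory Defs
  imports "HOL-Number_Theory.Cong"
begin

text \<open>
  An overpartition is written as the list of its parts; the Boolean attached to a part says
  whether that occurrence is overlined.  The condition on \<open>i < j\<close> says that an occurrence
  that is not the first one of its value is never overlined.
\<close>

definition overpartitions :: "nat \<Rightarrow> (nat \<times> bool) list set" where
  "overpartitions n =
     {xs. sorted_wrt (\<ge>) (map fst xs) \<and> (\<forall>k \<in> set (map fst xs). 0 < k) \<and>
          sum_list (map fst xs) = n \<and>
          (\<forall>i j. i < j \<longrightarrow> j < length xs \<longrightarrow> fst (xs ! i) = fst (xs ! j) \<longrightarrow> \<not> snd (xs ! j))}"

definition mex :: "(nat \<times> bool) list \<Rightarrow> nat" where
  "mex xs = (LEAST m. 0 < m \<and> m \<notin> set (map fst xs))"

definition mex_o :: "(nat \<times> bool) list \<Rightarrow> nat" where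
  "mex_o xs = (if odd (mex xs) then mex xs else 0)"

definition sigma_o_mex :: "nat \<Rightarrow> nat" where
  "sigma_o_mex n = (\<Sum>xs \<in> overpartitions n. mex_o xs)"

definition overpartitions_count_ge2 :: "nat \<Rightarrow> nat" where
  "overpartitions_count_ge2 n = card {xs \<in> overpartitions n. \<forall>k \<in> set (map fst xs). 2 \<le> k}"

text \<open>Finiteness ensures that the sum and the cardinality above are the genuine ones.\<close>

lemma length_le_sum_list:
  "(\<forall>k \<in> set ks. 0 < k) \<Longrightarrow> length ks \<le> sum_list (ks :: nat list)"
  by (induction ks) (auto simp: Suc_le_eq intro: add_less_le_mono)

lemma finite_overpartitions: "finite (overpartitions n)"
proof (rule finite_subset)
  show "overpartitions n \<subseteq> {xs. set xs \<subseteq> {..n} \<times> UNIV \<and> length xs \<le> n}"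
  proof
    fix xs assume xs: "xs \<in> overpartitions n"
    have "length xs \<le> n"
      using length_le_sum_list[of "map fst xs"] xs by (simp add: overpartitions_def)
    moreover have "set xs \<subseteq> {..n} \<times> UNIV"
    proof
      fix p assume "p \<in> set xs"
      then have "fst p \<le> sum_list (map fst xs)"
        by (intro member_le_sum_list) auto
      then show "p \<in> {..n} \<times> UNIV"
        using xs by (cases p) (simp add: overpartitions_def)
    qed
    ultimately show "xs \<in> {xs. set xs \<subseteq> {..n} \<times> UNIV \<and> length xs \<le> n}"
      by blast
  qed
  show "finite {xs :: (nat \<times> bool) list. set xs \<subseteq> {..n} \<times> UNIV \<and> length xs \<le> n}"
    by (rule finite_lists_length_le) simp
qed

end

theory Submission
  imports Defs
begin

text \<open>
  The values of the parts of an overpartition form an ordinary partition, and once this partition is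
  given, every value that occurs in it is overlined or not, independently of the others.  So a
  partition with \<open>d\<close> different part sizes underlies exactly \<open>2 ^ d\<close> overpartitions
  (\<open>card_overlinings\<close>), and the mex has the same value on all of them.  If the mex is odd
  and not \<open>1\<close>, it is at least \<open>3\<close>, so both \<open>1\<close> and \<open>2\<close>
  occur, \<open>d \<ge> 2\<close>, and these overpartitions together contribute a multiple of
  \<open>4\<close>.  Modulo \<open>4\<close> only the overpartitions with mex \<open>1\<close> remain.  Each of
  them contributes \<open>1\<close>, and they are the ones without a part \<open>1\<close>.
\<close>

text \<open>
  The rule on overlining speaks only of which entries have equal values, so it makes sense for the
  entries of any list, whatever their order.
\<close>

definition overlinings :: "nat list \<Rightarrow> (nat \<times> bool) list set" where
  "overlinings ks = {xs. map fst xs = ks \<and>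
     (\<forall>i j. i < j \<longrightarrow> j < length xs \<longrightarrow> fst (xs ! i) = fst (xs ! j) \<longrightarrow> \<not> snd (xs ! j))}"

text \<open>
  Only earlier entries restrict the mark of an entry, so a list of parts is best extended at its end:
  the new last part may be overlined exactly when its value is new.
\<close>

lemma overlinings_snoc:
  "overlinings (ks @ [k]) =
     (\<lambda>(xs, b). xs @ [(k, b)]) ` (overlinings ks \<times> {b. b \<longrightarrow> k \<notin> set ks})"
proof (intro equalityI subsetI)
  fix ys assume ys: "ys \<in> overlinings (ks @ [k])"
  then obtain xs b where eq: "ys = xs @ [(k, b)]" and ks: "map fst xs = ks"
    by (auto simp: overlinings_def map_eq_append_conv)
  have unmarked: "\<not> snd (ys ! j)" if "i < j" "j < length ys" "fst (ys ! i) = fst (ys ! j)" for i j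
    using ys that by (auto simp: overlinings_def)
  have "xs \<in> overlinings ks"
    unfolding overlinings_def
  proof (intro CollectI conjI allI impI)
    fix i j assume "i < j" "j < length xs" "fst (xs ! i) = fst (xs ! j)"
    then show "\<not> snd (xs ! j)"
      using unmarked[of i j] by (simp add: eq nth_append)
  qed (rule ks)
  moreover have "k \<notin> set ks" if b
  proof
    assume "k \<in> set ks"
    then obtain i where "i < length xs" "fst (xs ! i) = k"
      using ks by (auto simp: in_set_conv_nth)
    then show False
      using unmarked[of i "length xs"] \<open>b\<close> by (simp add: eq nth_append)
  qed
  ultimately show "ys \<in> (\<lambda>(xs, b). xs @ [(k, b)]) ` (overlinings ks \<times> {b. b \<longrightarrow> k \<notin> set ks})"
    using eq by auto
next
  fix ys
  assume "ys \<in> (\<lambda>(xs, b). xs @ [(k, b)]) ` (overlinings ks \<times> {b. b \<longrightarrow> k \<notin> set ks})"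
  then obtain xs b where eq: "ys = xs @ [(k, b)]" and xs: "xs \<in> overlinings ks"
    and b: "b \<longrightarrow> k \<notin> set ks"
    by auto
  have ks: "map fst xs = ks"
    using xs by (simp add: overlinings_def)
  show "ys \<in> overlinings (ks @ [k])"
    unfolding overlinings_def
  proof (intro CollectI conjI allI impI)
    show "map fst ys = ks @ [k]"
      by (simp add: eq ks)
    fix i j assume ij: "i < j" "j < length ys" "fst (ys ! i) = fst (ys ! j)"
    show "\<not> snd (ys ! j)"
    proof (cases "j < length xs")
      case True
      then show ?thesis
        using xs ij by (auto simp: eq nth_append overlinings_def)
    next
      case False
      then have j: "j = length xs"
        using ij by (simp add: eq)
      then have "k \<in> set ks"
        using ij ks by (auto simp: eq nth_append in_set_conv_nth)
      then show ?thesis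
        using b j by (simp add: eq)
    qed
  qed
qed

lemma card_overlinings: "card (overlinings ks) = 2 ^ card (set ks)"
proof (induction ks rule: rev_induct)
  case Nil
  have "overlinings [] = {[]}"
    by (auto simp: overlinings_def)
  then show ?case
    by simp
next
  case (snoc k ks)
  have "{b. b \<longrightarrow> k \<notin> set ks} = (if k \<in> set ks then {False} else UNIV)"
    by auto
  moreover have "inj_on (\<lambda>(xs, b). xs @ [(k, b)]) (overlinings ks \<times> {b. b \<longrightarrow> k \<notin> set ks})"
    by (auto simp: inj_on_def)
  ultimately show ?case
    using snoc.IH by (simp add: overlinings_snoc card_image card_cartesian_product insert_absorb)
qed

text \<open>
  Being an overpartition of \<open>n\<close> depends only on the underlying list of parts, apart from the
  rule on overlining, so the fibres of \<^term>\<open>map fst\<close> are full sets of overlinings.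
\<close>

lemma overpartitions_fibre:
  assumes "ys \<in> overpartitions n"
  shows "{xs \<in> overpartitions n. map fst xs = map fst ys} = overlinings (map fst ys)"
proof (intro equalityI subsetI)
  fix xs assume "xs \<in> overlinings (map fst ys)"
  then have "map fst xs = map fst ys"
    and "\<forall>i j. i < j \<longrightarrow> j < length xs \<longrightarrow> fst (xs ! i) = fst (xs ! j) \<longrightarrow> \<not> snd (xs ! j)"
    by (auto simp: overlinings_def)
  then show "xs \<in> {xs \<in> overpartitions n. map fst xs = map fst ys}"
    using assms unfolding overpartitions_def by (simp del: set_map)
qed (simp add: overpartitions_def overlinings_def)

text \<open>
  A statistic that ignores the overlining is constant on each fibre, and a fibre on which it does
  not vanish has a multiple of \<open>2 ^ r\<close> elements.
\<close>

lemma power_two_dvd_sum_overpartitions: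
  fixes f :: "(nat \<times> bool) list \<Rightarrow> nat"
  assumes cong: "\<And>xs ys. map fst xs = map fst ys \<Longrightarrow> f xs = f ys"
    and sizes: "\<And>xs. xs \<in> overpartitions n \<Longrightarrow> f xs \<noteq> 0 \<Longrightarrow> r \<le> card (set (map fst xs))"
  shows "2 ^ r dvd (\<Sum>xs \<in> overpartitions n. f xs)"
proof -
  have "2 ^ r dvd (\<Sum>xs \<in> {xs \<in> overpartitions n. map fst xs = ks}. f xs)"
    if "ks \<in> map fst ` overpartitions n" for ks
  proof -
    from that obtain ys where ys: "ys \<in> overpartitions n" and ks: "ks = map fst ys"
      by auto
    have "(\<Sum>xs \<in> {xs \<in> overpartitions n. map fst xs = ks}. f xs)
        = (\<Sum>xs \<in> {xs \<in> overpartitions n. map fst xs = ks}. f ys)"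
      by (rule sum.cong[OF refl], rule cong) (simp add: ks)
    also have "\<dots> = 2 ^ card (set ks) * f ys"
      using overpartitions_fibre[OF ys] by (simp add: ks card_overlinings del: set_map)
    finally have sum_fibre:
      "(\<Sum>xs \<in> {xs \<in> overpartitions n. map fst xs = ks}. f xs) = 2 ^ card (set ks) * f ys" .
    have "2 ^ r dvd 2 ^ card (set ks) * f ys"
    proof (cases "f ys = 0")
      case False
      then show ?thesis
        using sizes[OF ys] ks by (intro dvd_mult2 le_imp_power_dvd) simp
    qed simp
    then show ?thesis
      by (simp only: sum_fibre)
  qed
  then show ?thesis
    by (subst sum.image_gen[OF finite_overpartitions, of _ _ "map fst"]) (rule dvd_sum)
qed

lemma mex_cong: "map fst xs = map fst ys \<Longrightarrow> mex xs = mex ys"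
  unfolding mex_def by simp

lemma mex_pos_notin: "0 < mex xs \<and> mex xs \<notin> set (map fst xs)"
proof -
  have "infinite ({0<..} - set (map fst xs))"
    by (simp add: infinite_Ioi)
  then obtain m where "m \<in> {0<..} - set (map fst xs)"
    using infinite_imp_nonempty by blast
  then show ?thesis
    unfolding mex_def
    using LeastI[of "\<lambda>m. 0 < m \<and> m \<notin> set (map fst xs)" m] by blast
qed

lemma less_mex_in: "0 < k \<Longrightarrow> k < mex xs \<Longrightarrow> k \<in> set (map fst xs)"
  unfolding mex_def using not_less_Least by blast

lemma mex_eq_1_iff: "mex xs = 1 \<longleftrightarrow> 1 \<notin> set (map fst xs)"
proof
  assume "1 \<notin> set (map fst xs)"
  then have "\<not> 1 < mex xs"
    using less_mex_in[of 1 xs] by auto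
  then show "mex xs = 1"
    using mex_pos_notin[of xs] by simp
next
  assume "mex xs = 1"
  then show "1 \<notin> set (map fst xs)"
    using mex_pos_notin[of xs] by simp
qed

lemma two_le_card_parts_if_odd_mex:
  assumes "odd (mex xs)" "mex xs \<noteq> 1"
  shows "2 \<le> card (set (map fst xs))"
proof -
  have "3 \<le> mex xs"
    using assms by (auto elim!: oddE)
  then have "{1, 2} \<subseteq> set (map fst xs)"
    using less_mex_in[of 1 xs] less_mex_in[of 2 xs] by simp
  then have "card {1, 2 :: nat} \<le> card (set (map fst xs))"
    by (intro card_mono) simp_all
  then show ?thesis
    by simp
qed

lemma overpartitions_count_ge2_eq_mex:
  "overpartitions_count_ge2 n = card {xs \<in> overpartitions n. mex xs = 1}"
proof -
  have "(\<forall>k \<in> set (map fst xs). 2 \<le> k) \<longleftrightarrow> mex xs = 1" if "xs \<in> overpartitions n" for xs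
  proof -
    have "\<forall>k \<in> set (map fst xs). 0 < k"
      using that unfolding overpartitions_def by blast
    then have "(\<forall>k \<in> set (map fst xs). 2 \<le> k) \<longleftrightarrow> (\<forall>k \<in> set (map fst xs). k \<noteq> 1)"
      by (intro ball_cong) auto
    then show ?thesis
      unfolding mex_eq_1_iff by blast
  qed
  then show ?thesis
    unfolding overpartitions_count_ge2_def by (intro arg_cong[of _ _ card] Collect_cong) blast
qed

theorem corollary1p2:
  fixes n :: nat
  shows "[sigma_o_mex n = overpartitions_count_ge2 n] (mod 4)"
proof -
  define rest where "rest xs = (if mex xs = 1 then 0 else mex_o xs)" for xs
  have "sigma_o_mex n = (\<Sum>xs \<in> overpartitions n. (if mex xs = 1 then 1 else 0) + rest xs)"
    unfolding sigma_o_mex_def by (rule sum.cong) (simp_all add: rest_def mex_o_def)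
  also have "\<dots> = overpartitions_count_ge2 n + (\<Sum>xs \<in> overpartitions n. rest xs)"
    unfolding sum.distrib overpartitions_count_ge2_eq_mex card_eq_sum
    by (simp only: sum.inter_filter[OF finite_overpartitions])
  finally have split:
    "sigma_o_mex n = overpartitions_count_ge2 n + (\<Sum>xs \<in> overpartitions n. rest xs)" .
  have "2 ^ 2 dvd (\<Sum>xs \<in> overpartitions n. rest xs)"
  proof (rule power_two_dvd_sum_overpartitions)
    show "rest xs = rest ys" if "map fst xs = map fst ys" for xs ys
      using mex_cong[OF that] by (simp add: rest_def mex_o_def)
    show "2 \<le> card (set (map fst xs))" if "rest xs \<noteq> 0" for xs
      using that two_le_card_parts_if_odd_mex[of xs]
      by (simp add: rest_def mex_o_def split: if_splits)
  qed
  then have "[(\<Sum>xs \<in> overpartitions n. rest xs) = 0] (mod 4)"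
    by (simp add: cong_0_iff)
  from cong_add[OF cong_refl this, of "overpartitions_count_ge2 n"] show ?thesis
    by (simp add: split)
qed

end
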